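(* Let $\mathbb{H}$ be a complex Hilbert space and let $T \in B(\mathbb{H})$ be an invertible bounded linear operator with polar decomposition $T = U|T|$. Then $T$ has the bounded shadowing property if and only if its Aluthge transform $\Delta(T) = |T|^{1/2} U |T|^{1/2}$ has the bounded shadowing property.
   Context: $B(\mathbb{H})$ denotes the algebra of bounded linear operators on $\mathbb{H}$. For $T \in B(\mathbb{H})$, $|T| = (T^*T)^{1/2}$, and the polar decomposition $T = U|T|$ is the unique one in which $U$ is a partial isometry with $\ker U = \ker |T| = \ker T$. The Aluthge transform of $T$ is $\Delta(T) = |T|^{1/2} U |T|^{1/2}$. Bounded shadowing property: let $g : Y \to Y$ be a homeomorphism of a metric space $(Y,d)$. For $\delta > 0$, a $\delta$-pseudo orbit of $g$ is a sequence $(y_n)_{n \in \mathbb{Z}}$ in $Y$ with $d(g(y_n), y_{n+1}) \le \delta$ for all $n \in \mathbb{Z}$; it is bounded if $\{y_n : n \in \mathbb{Z}\}$ is a bounded subset of $Y$. It can be $\epsilon$-shadowed if there is $y \in Y$ with $d(g^n(y), y_n) \le \epsilon$ for all $n \in \mathbb{Z}$. The homeomorphism $g$ has the bounded shadowing property if for every $\epsilon > 0$ there is $\delta > 0$ such that every bounded $\delta$-pseudo orbit of $g$ can be $\epsilon$-shadowed. Here this is applied to invertible bounded operators on $\mathbb{H}$ with the metric induced by the norm. *)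

theory Defs
  imports "HOL-Analysis.Analysis"
begin

section \<open>Complex Hilbert spaces\<close>

text \<open>The libraries only have real inner product spaces. A complex Hilbert space is complete with
  respect to the norm of its complex inner product, and it is in particular a real Hilbert space
  with inner product \<open>Re \<langle>x, y\<rangle>\<close>, which induces the same norm and metric. The class below
  therefore extends the library's \<^class>\<open>real_inner\<close>: positive definiteness and
  \<open>norm x = sqrt (Re \<langle>x, x\<rangle>)\<close> are inherited through \<open>inner_eq_Re_cinner\<close>. The complex inner
  product is linear in its first argument.\<close>

class complex_hilbert = real_inner + complete_space +
  fixes scaleC :: "complex \<Rightarrow> 'a \<Rightarrow> 'a" (infixr "*\<^sub>C" 75)
    and cinner :: "'a \<Rightarrow> 'a \<Rightarrow> complex"
  assumes scaleC_add_right: "a *\<^sub>C (x + y) = a *\<^sub>C x + a *\<^sub>C y"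
    and scaleC_add_left: "(a + b) *\<^sub>C x = a *\<^sub>C x + b *\<^sub>C x"
    and scaleC_scaleC: "a *\<^sub>C (b *\<^sub>C x) = (a * b) *\<^sub>C x"
    and scaleC_of_real: "complex_of_real r *\<^sub>C x = r *\<^sub>R x"
    and cinner_add_left: "cinner (x + y) z = cinner x z + cinner y z"
    and cinner_scaleC_left: "cinner (a *\<^sub>C x) y = a * cinner x y"
    and cinner_commute: "cinner x y = cnj (cinner y x)"
    and inner_eq_Re_cinner: "inner x y = Re (cinner x y)"

section \<open>Bounded operators\<close>

definition bounded_clinear :: "('a::complex_hilbert \<Rightarrow> 'a) \<Rightarrow> bool" where
  "bounded_clinear T \<longleftrightarrow> bounded_linear T \<and> (\<forall>c x. T (c *\<^sub>C x) = c *\<^sub>C T x)"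

definition invertible_op :: "('a::complex_hilbert \<Rightarrow> 'a) \<Rightarrow> bool" where
  "invertible_op T \<longleftrightarrow>
     bounded_clinear T \<and> (\<exists>S. bounded_clinear S \<and> S \<circ> T = id \<and> T \<circ> S = id)"

definition op_kernel :: "('a::complex_hilbert \<Rightarrow> 'a) \<Rightarrow> 'a set" where
  "op_kernel T = {x. T x = 0}"

definition adjoint_op :: "('a::complex_hilbert \<Rightarrow> 'a) \<Rightarrow> 'a \<Rightarrow> 'a" where
  "adjoint_op T = (THE S. bounded_clinear S \<and> (\<forall>x y. cinner (T x) y = cinner x (S y)))"

definition positive_op :: "('a::complex_hilbert \<Rightarrow> 'a) \<Rightarrow> bool" where
  "positive_op A \<longleftrightarrow>
     bounded_clinear A \<and> (\<forall>x. cinner (A x) x \<in> \<real> \<and> 0 \<le> Re (cinner (A x) x))"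

text \<open>The unique positive square root; only meaningful for positive operators.\<close>

definition sqrt_op :: "('a::complex_hilbert \<Rightarrow> 'a) \<Rightarrow> 'a \<Rightarrow> 'a" where
  "sqrt_op A = (THE P. positive_op P \<and> P \<circ> P = A)"

definition abs_op :: "('a::complex_hilbert \<Rightarrow> 'a) \<Rightarrow> 'a \<Rightarrow> 'a" where
  "abs_op T = sqrt_op (adjoint_op T \<circ> T)"

definition partial_isometry :: "('a::complex_hilbert \<Rightarrow> 'a) \<Rightarrow> bool" where
  "partial_isometry U \<longleftrightarrow>
     bounded_clinear U \<and> (\<forall>x. (\<forall>z\<in>op_kernel U. cinner x z = 0) \<longrightarrow> norm (U x) = norm x)"

definition polar_isometry :: "('a::complex_hilbert \<Rightarrow> 'a) \<Rightarrow> 'a \<Rightarrow> 'a" where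
  "polar_isometry T = (THE U. partial_isometry U \<and> T = U \<circ> abs_op T \<and>
     op_kernel U = op_kernel (abs_op T) \<and> op_kernel (abs_op T) = op_kernel T)"

definition aluthge :: "('a::complex_hilbert \<Rightarrow> 'a) \<Rightarrow> 'a \<Rightarrow> 'a" where
  "aluthge T = sqrt_op (abs_op T) \<circ> polar_isometry T \<circ> sqrt_op (abs_op T)"

section \<open>Bounded shadowing\<close>

definition int_iterate :: "('a \<Rightarrow> 'a) \<Rightarrow> int \<Rightarrow> 'a \<Rightarrow> 'a" where
  "int_iterate g n = (if 0 \<le> n then g ^^ nat n else inv g ^^ nat (- n))"

definition pseudo_orbit :: "('a::metric_space \<Rightarrow> 'a) \<Rightarrow> real \<Rightarrow> (int \<Rightarrow> 'a) \<Rightarrow> bool" where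
  "pseudo_orbit g \<delta> y \<longleftrightarrow> (\<forall>n. dist (g (y n)) (y (n + 1)) \<le> \<delta>)"

definition shadowed :: "('a::metric_space \<Rightarrow> 'a) \<Rightarrow> real \<Rightarrow> (int \<Rightarrow> 'a) \<Rightarrow> bool" where
  "shadowed g \<epsilon> y \<longleftrightarrow> (\<exists>x. \<forall>n. dist (int_iterate g n x) (y n) \<le> \<epsilon>)"

text \<open>The property is defined for homeomorphisms only, so being one is part of the definition.\<close>

definition bounded_shadowing :: "('a::metric_space \<Rightarrow> 'a) \<Rightarrow> bool" where
  "bounded_shadowing g \<longleftrightarrow> homeomorphism UNIV UNIV g (inv g) \<and>
     (\<forall>\<epsilon>>0. \<exists>\<delta>>0. \<forall>y. pseudo_orbit g \<delta> y \<and> bounded (range y) \<longrightarrow> shadowed g \<epsilon> y)"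

end

theory Submission
  imports Defs
begin

text \<open>
  For an invertible \<open>T\<close> the Aluthge transform is similar to \<open>T\<close>: the polar isometry is
  \<open>U = T |T|\<^sup>-\<^sup>1\<close>, so with \<open>Q = |T|\<^sup>1\<^sup>/\<^sup>2\<close> one gets
  \<open>\<Delta>(T) = Q T Q\<^sup>-\<^sup>2 Q = Q T Q\<^sup>-\<^sup>1\<close> (\<open>aluthge_similar\<close>). Both \<open>Q\<close> and its inverse are bounded
  linear, hence Lipschitz, and a bi-Lipschitz conjugacy carries bounded pseudo orbits to bounded
  pseudo orbits and shadowing orbits to shadowing orbits, changing \<open>\<delta>\<close> and \<open>\<epsilon>\<close> only by constant
  factors (\<open>bounded_shadowing_conjugate\<close>).

  Most of the work goes into showing that the objects in this computation exist and are what their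
  descriptions say. The adjoint comes from the Riesz representation theorem. For square roots it is
  enough to treat a symmetric operator \<open>A\<close> with \<open>c \<parallel>x\<parallel>\<^sup>2 \<le> \<langle>A x, x\<rangle>\<close> for some \<open>c > 0\<close>: \<open>T\<^sup>* T\<close> is of
  this kind because \<open>T\<close> is bounded below, and the square root constructed here is of this kind again, so
  that the construction can be repeated on \<open>|T|\<close>. After scaling, \<open>A = I - B\<close> with \<open>\<parallel>B\<parallel> < 1\<close>, and a
  square root \<open>I - X\<close> is given by a fixed point \<open>X = (B + X\<^sup>2) / 2\<close>, which Banach's theorem provides
  without any functional calculus (\<open>contraction_sqrt_fixpoint\<close>). The fixed point commutes with
  everything that commutes with \<open>B\<close>. That single property gives both the uniqueness of the positive
  square root and, applied to the operators \<open>x \<mapsto> c x\<close> with complex \<open>c\<close>, its complex linearity; therefore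
  the analysis up to that point can be done in real Hilbert spaces.
\<close>

section \<open>Riesz representation and adjoints\<close>

text \<open>The representing vector is the minimiser of \<open>q x = \<parallel>x\<parallel>\<^sup>2 - 2 f x\<close>, which equals
  \<open>\<parallel>x - a\<parallel>\<^sup>2 - \<parallel>a\<parallel>\<^sup>2\<close> if \<open>f = \<langle>a, \<cdot>\<rangle>\<close>. By the parallelogram law minimising sequences are Cauchy,
  and vanishing of the first variation at the minimiser is the representation.\<close>

theorem riesz_representation:
  fixes f :: "'a::{real_inner, banach} \<Rightarrow> real"
  assumes "bounded_linear f"
  obtains a where "\<And>x. f x = inner a x"
proof -
  interpret f: bounded_linear f by fact
  define q where "q x = (norm x)\<^sup>2 - 2 * f x" for x
  obtain K where K: "\<And>x. norm (f x) \<le> norm x * K"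
    using f.bounded by blast
  have q_ge: "- (K\<^sup>2) \<le> q x" for x
  proof -
    have "f x \<le> norm x * K"
      using K[of x] by simp
    moreover have "0 \<le> (norm x - K)\<^sup>2"
      by simp
    ultimately show ?thesis
      unfolding q_def power2_diff by linarith
  qed
  define m where "m = (INF x. q x)"
  have bdd: "bdd_below (range q)"
    using q_ge by (auto intro!: bdd_belowI[of _ "- (K\<^sup>2)"])
  have m_le: "m \<le> q x" for x
    unfolding m_def using bdd by (intro cINF_lower) auto
  have midpoint: "(dist x y)\<^sup>2 \<le> 2 * (q x - m) + 2 * (q y - m)" for x y
  proof -
    have "q ((1/2) *\<^sub>R (x + y)) = (q x + q y) / 2 - (dist x y)\<^sup>2 / 4"
      unfolding q_def f.scaleR f.add dist_norm power2_norm_eq_inner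
      by (simp add: inner_add inner_diff inner_commute field_simps)
    with m_le[of "(1/2) *\<^sub>R (x + y)"] show ?thesis
      by (simp add: field_simps)
  qed
  have "\<exists>x. q x < m + 1 / real (Suc n)" for n
    using cINF_less_iff[of UNIV q "m + 1 / real (Suc n)"] bdd
    by (auto simp: m_def)
  then obtain X where X: "\<And>n. q (X n) < m + 1 / real (Suc n)"
    by metis
  have "Cauchy X"
  proof (rule metric_CauchyI)
    fix e :: real assume "0 < e"
    then obtain N where N: "1 / real (Suc N) < e\<^sup>2 / 4"
      using nat_approx_posE[of "e\<^sup>2 / 4"] by auto
    have small: "q (X n) - m < e\<^sup>2 / 4" if "n \<ge> N" for n
    proof -
      have "1 / real (Suc n) \<le> 1 / real (Suc N)"
        using that by (simp add: field_simps)
      with X[of n] N show ?thesis by linarith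
    qed
    have "dist (X i) (X j) < e" if "i \<ge> N" "j \<ge> N" for i j
    proof (rule power2_less_imp_less)
      have "(dist (X i) (X j))\<^sup>2 \<le> 2 * (q (X i) - m) + 2 * (q (X j) - m)"
        by (rule midpoint)
      also have "\<dots> < 2 * (e\<^sup>2 / 4) + 2 * (e\<^sup>2 / 4)"
        using small that by (intro add_strict_mono mult_strict_left_mono) auto
      finally show "(dist (X i) (X j))\<^sup>2 < e\<^sup>2"
        by simp
    qed (use \<open>0 < e\<close> in simp)
    then show "\<exists>M. \<forall>i\<ge>M. \<forall>j\<ge>M. dist (X i) (X j) < e"
      by blast
  qed
  then obtain a where a: "X \<longlonglongrightarrow> a"
    using Cauchy_convergent convergent_def by blast
  have "(\<lambda>n. q (X n)) \<longlonglongrightarrow> q a"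
    unfolding q_def by (intro tendsto_intros f.tendsto a)
  moreover have "(\<lambda>n. m + 1 / real (Suc n)) \<longlonglongrightarrow> m + 0"
    by (intro tendsto_intros LIMSEQ_Suc[OF lim_1_over_n])
  ultimately have "q a \<le> m + 0"
    by (rule LIMSEQ_le) (use X less_imp_le in blast)
  then have min: "q a \<le> q x" for x
    using m_le[of x] by simp
  have "f x = inner a x" for x
  proof (cases "x = 0")
    case False
    \<comment> \<open>\<open>t\<close> minimises the quadratic polynomial \<open>q (a + t x)\<close>; its value there is
      \<open>q a - d\<^sup>2 / \<parallel>x\<parallel>\<^sup>2\<close>.\<close>
    define d where "d = inner a x - f x"
    define t where "t = - d / (norm x)\<^sup>2"
    have pos: "(norm x)\<^sup>2 > 0"
      using False by simp
    have "q (a + t *\<^sub>R x) = q a + t\<^sup>2 * (norm x)\<^sup>2 + 2 * t * d"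
      unfolding q_def d_def f.scaleR f.add power2_norm_eq_inner
      by (simp add: inner_add inner_commute algebra_simps power2_eq_square)
    then have "0 \<le> t\<^sup>2 * (norm x)\<^sup>2 + 2 * t * d"
      using min[of "a + t *\<^sub>R x"] by simp
    also have "\<dots> = - (d\<^sup>2 / (norm x)\<^sup>2)"
      using pos unfolding t_def by (simp add: field_simps power2_eq_square)
    finally have "d\<^sup>2 / (norm x)\<^sup>2 \<le> 0"
      by simp
    with pos have "d\<^sup>2 \<le> 0"
      by (simp add: divide_le_0_iff)
    then show ?thesis
      by (simp add: d_def)
  qed simp
  then show thesis
    by (rule that)
qed

lemma real_adjoint_exists:
  fixes T :: "'a::{real_inner, banach} \<Rightarrow> 'a"
  assumes "bounded_linear T"
  obtains S where "bounded_linear S" "\<And>x y. inner (T x) y = inner x (S y)"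
proof -
  interpret T: bounded_linear T by fact
  have "\<exists>z. \<forall>x. inner (T x) y = inner z x" for y
    using riesz_representation[OF bounded_linear_compose[OF bounded_linear_inner_left assms]]
    by metis
  then obtain S where S: "\<And>x y. inner (T x) y = inner x (S y)"
    by (metis inner_commute)
  obtain K where K: "\<And>x. norm (T x) \<le> norm x * K"
    using T.bounded by blast
  have "bounded_linear S"
  proof (rule bounded_linear_intro)
    show "S (x + y) = S x + S y" for x y
      by (rule vector_eq_rdot[THEN iffD1]) (metis S inner_add_right inner_commute)
    show "S (r *\<^sub>R x) = r *\<^sub>R S x" for r x
      by (rule vector_eq_rdot[THEN iffD1]) (metis S inner_scaleR_right inner_commute)
    show "norm (S y) \<le> norm y * K" for y
    proof (cases "S y = 0")
      case True
      have "0 \<le> norm y * K"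
        using K[of y] norm_ge_zero order_trans by blast
      with True show ?thesis by simp
    next
      case False
      have "norm (S y) * norm (S y) = inner (T (S y)) y"
        by (simp add: S flip: power2_eq_square power2_norm_eq_inner)
      also have "\<dots> \<le> norm (T (S y)) * norm y"
        by (rule norm_cauchy_schwarz)
      also have "\<dots> \<le> (norm (S y) * K) * norm y"
        using K by (intro mult_right_mono) auto
      finally show ?thesis
        using False by (simp add: mult.assoc mult.commute)
    qed
  qed
  with S show thesis
    by (rule that[rotated])
qed

section \<open>Square roots of coercive symmetric operators\<close>

definition coercive_symmetric :: "('a::real_inner \<Rightarrow> 'a) \<Rightarrow> bool" where
  "coercive_symmetric A \<longleftrightarrow> bounded_linear A \<and> (\<forall>x y. inner (A x) y = inner x (A y)) \<and>
     (\<exists>c>0. \<forall>x. c * (norm x)\<^sup>2 \<le> inner (A x) x)"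

lemma coercive_symmetric_expanding:
  assumes "coercive_symmetric A"
  obtains c where "c > 0" "\<And>x. c * norm x \<le> norm (A x)"
proof -
  obtain c where c: "c > 0" "\<And>x. c * (norm x)\<^sup>2 \<le> inner (A x) x"
    using assms unfolding coercive_symmetric_def by blast
  have "c * norm x \<le> norm (A x)" for x
  proof (cases "x = 0")
    case False
    have "(c * norm x) * norm x \<le> norm (A x) * norm x"
      using c(2)[of x] norm_cauchy_schwarz[of "A x" x] by (simp add: power2_eq_square mult.assoc)
    with False show ?thesis by simp
  qed simp
  with c(1) show thesis by (rule that)
qed

text \<open>Expanding the square, \<open>\<parallel>x - t A x\<parallel>\<^sup>2 \<le> (1 - 2 t c + t\<^sup>2 M\<^sup>2) \<parallel>x\<parallel>\<^sup>2\<close> when \<open>A\<close> has coercivity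
  constant \<open>c\<close> and norm at most \<open>M\<close>. The factor is smallest at \<open>t = c / M\<^sup>2\<close>, where it is
  \<open>1 - (c / M)\<^sup>2\<close>.\<close>

lemma coercive_symmetric_eq_id_minus_contraction:
  fixes A :: "'a::real_inner \<Rightarrow> 'a"
  assumes "coercive_symmetric A"
  obtains t r :: real and B :: "'a \<Rightarrow>\<^sub>L 'a"
  where "t > 0" "0 \<le> r" "r < 1" "norm B \<le> r" "\<And>x. blinfun_apply B x = x - t *\<^sub>R A x"
proof -
  interpret A: bounded_linear A
    using assms by (simp add: coercive_symmetric_def)
  obtain c where c: "c > 0" "\<And>x. c * (norm x)\<^sup>2 \<le> inner (A x) x"
    using assms unfolding coercive_symmetric_def by blast
  obtain K where K: "K > 0" "\<And>x. norm (A x) \<le> norm x * K"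
    using A.pos_bounded by blast
  \<comment> \<open>On the zero space \<open>c\<close> may exceed \<open>K\<close>; adding it keeps \<open>1 - (c / M)\<^sup>2\<close> positive.\<close>
  define M where "M = K + c"
  have M: "M > 0" "c < M" "\<And>x. norm (A x) \<le> M * norm x"
    using c(1) K by (auto simp: M_def algebra_simps intro: order_trans[OF K(2)])
  define t where "t = c / M\<^sup>2"
  define r where "r = sqrt (1 - (c / M)\<^sup>2)"
  define B where "B = Blinfun (\<lambda>x. x - t *\<^sub>R A x)"
  have B: "blinfun_apply B x = x - t *\<^sub>R A x" for x
    unfolding B_def
    by (subst bounded_linear_Blinfun_apply) (intro bounded_linear_intros A.bounded_linear_axioms, rule refl)
  have t: "t > 0"
    using c M by (simp add: t_def)
  have frac: "0 < c / M" "c / M < 1"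
    using c M by auto
  then have sq: "0 < (c / M)\<^sup>2" "(c / M)\<^sup>2 < 1"
    using power_less_one_iff[of "c / M" 2] by (simp_all only: zero_less_power) auto
  have r: "0 \<le> r" "r < 1" "r\<^sup>2 = 1 - (c / M)\<^sup>2"
    using sq by (auto simp: r_def)
  have "norm (blinfun_apply B x) \<le> r * norm x" for x
  proof (rule power2_le_imp_le)
    have "(norm (blinfun_apply B x))\<^sup>2 = (norm x)\<^sup>2 - 2 * t * inner (A x) x + t\<^sup>2 * (norm (A x))\<^sup>2"
      unfolding B power2_norm_eq_inner
      by (simp add: inner_diff inner_commute algebra_simps power2_eq_square)
    also have "\<dots> \<le> (norm x)\<^sup>2 - 2 * t * (c * (norm x)\<^sup>2) + t\<^sup>2 * (M * norm x)\<^sup>2"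
      using c(2)[of x] M(3)[of x] t
      by (intro add_mono diff_mono mult_left_mono power_mono) auto
    also have "\<dots> = (r * norm x)\<^sup>2"
      unfolding power_mult_distrib r(3) t_def using M(1)
      by (simp add: field_simps power2_eq_square)
    finally show "(norm (blinfun_apply B x))\<^sup>2 \<le> (r * norm x)\<^sup>2" .
  qed (use r in simp)
  then have "norm B \<le> r"
    using r(1) by (intro norm_blinfun_bound)
  with t r(1,2) B show thesis
    by (intro that)
qed

text \<open>The equation says \<open>(I - X)\<^sup>2 = I - B\<close>. On the ball of radius \<open>r\<close> the map
  \<open>X \<mapsto> (B + X\<^sup>2) / 2\<close> has Lipschitz constant \<open>r\<close>. The operators that are symmetric and commute with
  the commutant of \<open>B\<close> form a closed set which the map preserves, so the fixed point may be sought in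
  there.\<close>

lemma contraction_sqrt_fixpoint:
  fixes B :: "'a::{real_inner, banach} \<Rightarrow>\<^sub>L 'a"
  assumes r: "0 \<le> r" "r < 1" "norm B \<le> r"
    and sym: "\<And>x y. inner (B x) y = inner x (B y)"
  obtains X :: "'a \<Rightarrow>\<^sub>L 'a" where "norm X \<le> r" "X + X = B + (X o\<^sub>L X)"
    "\<And>x y. inner (X x) y = inner x (X y)"
    "\<And>C. C o\<^sub>L B = B o\<^sub>L C \<Longrightarrow> C o\<^sub>L X = X o\<^sub>L C"
proof -
  define F where "F X = (1/2) *\<^sub>R (B + (X o\<^sub>L X))" for X
  define S where "S = cball 0 r \<inter> {X. \<forall>x y. inner (blinfun_apply X x) y = inner x (X y)} \<inter>
    {X. \<forall>C. C o\<^sub>L B = B o\<^sub>L C \<longrightarrow> C o\<^sub>L X = X o\<^sub>L C}"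
  note bil = bounded_bilinear_blinfun_compose
  have "\<exists>!X\<in>S. F X = X"
  proof (rule Banach_fix)
    have "closed {X. \<forall>x y. inner (blinfun_apply X x) y = inner x (X y)}"
      by (intro closed_Collect_all closed_Collect_eq continuous_intros)
    moreover have "closed {X. \<forall>C. C o\<^sub>L B = B o\<^sub>L C \<longrightarrow> C o\<^sub>L X = X o\<^sub>L C}"
      by (intro closed_Collect_all closed_Collect_imp closed_Collect_eq open_Collect_const continuous_intros
        bounded_bilinear.continuous_on[OF bil])
    ultimately show "complete S"
      unfolding S_def by (intro closed_Int closed_cball complete_eq_closed[THEN iffD2])
    have "0 \<in> S"
      using r by (simp add: S_def)
    then show "S \<noteq> {}" by blast
    show "F ` S \<subseteq> S"
    proof safe
      fix X assume X: "X \<in> S"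
      then have n: "norm X \<le> r" by (simp add: S_def)
      have "norm (X o\<^sub>L X) \<le> r * 1"
        using norm_blinfun_compose[of X X] n r
        by (meson mult_mono norm_ge_zero order_trans less_imp_le)
      then have "norm (F X) \<le> r"
        using norm_triangle_ineq[of B "X o\<^sub>L X"] r by (simp add: F_def)
      moreover have "inner (F X x) y = inner x (F X y)" for x y
      proof -
        have X_sym: "\<And>x y. inner (X x) y = inner x (X y)"
          using X by (simp add: S_def)
        have "inner (X (X x)) y = inner x (X (X y))"
          using X_sym[of "X x" y] X_sym[of x "X y"] by (rule trans)
        then show ?thesis
          by (simp add: F_def blinfun.scaleR_left blinfun.add_left inner_add sym)
      qed
      moreover have "C o\<^sub>L F X = F X o\<^sub>L C" if "C o\<^sub>L B = B o\<^sub>L C" for C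
      proof -
        have "C o\<^sub>L X = X o\<^sub>L C"
          using X that by (simp add: S_def)
        then have "C (X x) = X (C x)" "C (B x) = B (C x)" for x
          using that by (metis blinfun_apply_blinfun_compose)+
        then show ?thesis
          by (intro blinfun_eqI)
            (simp add: F_def blinfun.scaleR_left blinfun.scaleR_right blinfun.add_left blinfun.add_right)
      qed
      ultimately show "F X \<in> S"
        by (simp add: S_def)
    qed
    fix X Y assume "X \<in> S" "Y \<in> S"
    then have n: "norm X \<le> r" "norm Y \<le> r" by (auto simp: S_def)
    \<comment> \<open>\<open>X\<^sup>2 - Y\<^sup>2 = X (X - Y) + (X - Y) Y\<close>, also for operators that do not commute.\<close>
    have "F X - F Y = (1/2) *\<^sub>R ((X o\<^sub>L (X - Y)) + ((X - Y) o\<^sub>L Y))"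
      by (simp add: F_def bounded_bilinear.diff_left[OF bil] bounded_bilinear.diff_right[OF bil]
        scaleR_diff_right scaleR_add_right)
    then have "dist (F X) (F Y) \<le> (1/2) * (norm (X o\<^sub>L (X - Y)) + norm ((X - Y) o\<^sub>L Y))"
      by (simp add: dist_norm norm_triangle_ineq)
    also have "\<dots> \<le> (1/2) * (r * norm (X - Y) + norm (X - Y) * r)"
      using n by (intro mult_left_mono add_mono order_trans[OF norm_blinfun_compose] mult_right_mono mult_left_mono) auto
    finally show "dist (F X) (F Y) \<le> r * dist X Y"
      by (simp add: dist_norm mult.commute)
  qed (use r in auto)
  then obtain X where X: "X \<in> S" "F X = X" by blast
  show thesis
  proof
    have "(2::real) *\<^sub>R X = 2 *\<^sub>R F X"
      using X(2) by simp
    then show "X + X = B + (X o\<^sub>L X)"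
      by (simp add: F_def flip: scaleR_2)
  qed (use X(1) in \<open>auto simp: S_def\<close>)
qed

text \<open>The commutation property is what later uses of the square root depend on: it replaces the
  description of the square root as a limit of polynomials in \<open>A\<close>.\<close>

lemma coercive_symmetric_sqrt:
  fixes A :: "'a::{real_inner, banach} \<Rightarrow> 'a"
  assumes A: "coercive_symmetric A"
  obtains P where "coercive_symmetric P" "P \<circ> P = A"
    "\<And>C. bounded_linear C \<Longrightarrow> C \<circ> A = A \<circ> C \<Longrightarrow> C \<circ> P = P \<circ> C"
proof -
  interpret A: bounded_linear A
    using assms by (simp add: coercive_symmetric_def)
  have A_sym: "inner (A x) y = inner x (A y)" for x y
    using assms by (simp add: coercive_symmetric_def)
  obtain t r and B :: "'a \<Rightarrow>\<^sub>L 'a" where t: "t > 0" and r: "0 \<le> r" "r < 1" "norm B \<le> r"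
    and B: "\<And>x. blinfun_apply B x = x - t *\<^sub>R A x"
    using coercive_symmetric_eq_id_minus_contraction[OF A] by blast
  have "inner (B x) y = inner x (B y)" for x y
    by (simp add: B inner_diff A_sym)
  then obtain X :: "'a \<Rightarrow>\<^sub>L 'a" where X: "norm X \<le> r" "X + X = B + (X o\<^sub>L X)"
    "\<And>x y. inner (X x) y = inner x (X y)"
    "\<And>C. C o\<^sub>L B = B o\<^sub>L C \<Longrightarrow> C o\<^sub>L X = X o\<^sub>L C"
    using contraction_sqrt_fixpoint[OF r] by blast
  define s where "s = 1 / sqrt t"
  have s: "s > 0" "s * s * t = 1"
    using t by (simp_all add: s_def)
  define P where "P x = s *\<^sub>R (x - X x)" for x
  have "bounded_linear P"
    unfolding P_def by (intro bounded_linear_intros)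
  moreover have "inner (P x) y = inner x (P y)" for x y
    by (simp add: P_def inner_diff X)
  moreover have "(s * (1 - r)) * (norm x)\<^sup>2 \<le> inner (P x) x" for x
  proof -
    have "inner (X x) x \<le> norm (X x) * norm x"
      by (rule norm_cauchy_schwarz)
    also have "\<dots> \<le> (r * norm x) * norm x"
      using X(1) by (intro mult_right_mono order_trans[OF norm_blinfun]) auto
    finally have "(1 - r) * (norm x)\<^sup>2 \<le> inner (x - X x) x"
      by (simp add: inner_diff power2_norm_eq_inner algebra_simps power2_eq_square
          flip: power2_norm_eq_inner)
    then have "s * ((1 - r) * (norm x)\<^sup>2) \<le> s * inner (x - X x) x"
      using s by (intro mult_left_mono) auto
    then show ?thesis
      by (simp add: P_def mult.assoc)
  qed
  ultimately have "coercive_symmetric P"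
    unfolding coercive_symmetric_def using s(1) r(2) by (metis diff_gt_0_iff_gt mult_pos_pos)
  moreover have "P \<circ> P = A"
  proof
    fix x
    have "X x + X x = B x + X (X x)"
      using arg_cong[OF X(2), of "\<lambda>Z. blinfun_apply Z x"] by (simp add: blinfun.add_left)
    then have "x - X x - X (x - X x) = t *\<^sub>R A x"
      by (simp add: B blinfun.diff_right algebra_simps)
    then show "(P \<circ> P) x = A x"
      by (simp add: P_def blinfun.scaleR_right s(2)[unfolded mult.assoc] flip: scaleR_diff_right)
  qed
  moreover have "C \<circ> P = P \<circ> C" if C: "bounded_linear C" "C \<circ> A = A \<circ> C" for C
  proof -
    interpret C: bounded_linear C by fact
    have app: "blinfun_apply (Blinfun C) = C"
      using C(1) by (rule bounded_linear_Blinfun_apply)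
    have CA: "C (A x) = A (C x)" for x
      using C(2) by (metis comp_apply)
    have "Blinfun C o\<^sub>L B = B o\<^sub>L Blinfun C"
      by (intro blinfun_eqI) (simp add: app B C.diff C.scaleR CA)
    then have "Blinfun C o\<^sub>L X = X o\<^sub>L Blinfun C"
      by (rule X(4))
    then have "C (X x) = X (C x)" for x
      by (metis app blinfun_apply_blinfun_compose)
    then show ?thesis
      by (auto simp: P_def C.diff C.scaleR)
  qed
  ultimately show thesis
    by (rule that)
qed

text \<open>For commuting square roots \<open>(P + Q) (Q - P) = Q\<^sup>2 - P\<^sup>2 = 0\<close>, and \<open>P + Q\<close> is injective because
  it inherits coercivity from \<open>P\<close>.\<close>

lemma nonneg_sqrt_unique:
  assumes P: "coercive_symmetric P" and Q: "bounded_linear Q" "\<And>x. 0 \<le> inner (Q x) x"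
    and eq: "Q \<circ> Q = P \<circ> P" and comm: "Q \<circ> P = P \<circ> Q"
  shows "Q = P"
proof
  fix x
  interpret P: bounded_linear P
    using P by (simp add: coercive_symmetric_def)
  interpret Q: bounded_linear Q by fact
  obtain c where c: "c > 0" "\<And>x. c * (norm x)\<^sup>2 \<le> inner (P x) x"
    using P unfolding coercive_symmetric_def by blast
  define y where "y = Q x - P x"
  have "P (P x) = Q (Q x)" "Q (P x) = P (Q x)"
    using eq comm by (metis comp_apply)+
  then have "P y + Q y = 0"
    by (simp add: y_def P.diff Q.diff)
  then have "inner (P y) y + inner (Q y) y = 0"
    by (metis inner_add_left inner_zero_left)
  with c(2)[of y] Q(2)[of y] have "c * (norm y)\<^sup>2 \<le> 0"
    by linarith
  with c(1) have "y = 0"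
    by (simp add: mult_le_0_iff)
  then show "Q x = P x"
    by (simp add: y_def)
qed

section \<open>Complex linear operators\<close>

instance complex_hilbert \<subseteq> banach ..

lemma inner_scaleC_left: "inner (c *\<^sub>C x) y = inner x (cnj c *\<^sub>C (y::'a::complex_hilbert))"
proof -
  have "cinner x (cnj c *\<^sub>C y) = c * cinner x y"
    by (metis cinner_commute cinner_scaleC_left complex_cnj_cnj complex_cnj_mult)
  then show ?thesis
    by (simp add: inner_eq_Re_cinner cinner_scaleC_left)
qed

text \<open>Through this identity, an adjointness or symmetry relation between complex linear operators
  passes from the real inner product to the complex one.\<close>

lemma Im_cinner: "Im (cinner x y) = inner ((- \<i>) *\<^sub>C x) y"
  by (simp add: inner_eq_Re_cinner cinner_scaleC_left)

lemma bounded_linear_scaleC: "bounded_linear (\<lambda>x::'a::complex_hilbert. c *\<^sub>C x)"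
proof (rule bounded_linear_intro)
  show "c *\<^sub>C (r *\<^sub>R x) = r *\<^sub>R (c *\<^sub>C x)" for r and x :: 'a
    by (metis mult.commute scaleC_of_real scaleC_scaleC)
  show "norm (c *\<^sub>C x) \<le> norm x * cmod c" for x :: 'a
  proof (rule power2_le_imp_le)
    have "(norm (c *\<^sub>C x))\<^sup>2 = inner x ((cnj c * c) *\<^sub>C x)"
      by (simp add: power2_norm_eq_inner inner_scaleC_left scaleC_scaleC)
    also have "cnj c * c = complex_of_real ((cmod c)\<^sup>2)"
      by (metis complex_norm_square mult.commute)
    also have "inner x (\<dots> *\<^sub>C x) = (norm x * cmod c)\<^sup>2"
      by (simp only: scaleC_of_real) (simp add: power_mult_distrib power2_norm_eq_inner)
    finally show "(norm (c *\<^sub>C x))\<^sup>2 \<le> (norm x * cmod c)\<^sup>2"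
      by simp
  qed simp
qed (rule scaleC_add_right)

lemma bounded_clinear_comp:
  "bounded_clinear S \<Longrightarrow> bounded_clinear T \<Longrightarrow> bounded_clinear (S \<circ> T)"
  unfolding bounded_clinear_def comp_def by (auto intro: bounded_linear_compose)

lemma bounded_clinear_inverse:
  assumes "bounded_clinear T" "bij T" "c > 0" "\<And>x. c * norm x \<le> norm (T x)"
  shows "bounded_clinear (inv T)"
proof -
  interpret T: bounded_linear T
    using assms(1) by (simp add: bounded_clinear_def)
  have T_inv: "T (inv T x) = x" and inv_T: "inv T (T x) = x" for x
    using assms(2) by (simp_all add: bij_is_surj bij_is_inj surj_f_inv_f inv_f_f)
  have "bounded_linear (inv T)"
  proof (rule bounded_linear_intro)
    show "inv T (x + y) = inv T x + inv T y" for x y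
      by (metis T.add T_inv inv_T)
    show "inv T (a *\<^sub>R x) = a *\<^sub>R inv T x" for a x
      by (metis T.scaleR T_inv inv_T)
    show "norm (inv T x) \<le> norm x * (1 / c)" for x
      using assms(3) assms(4)[of "inv T x"] by (simp add: T_inv field_simps)
  qed
  moreover have "inv T (a *\<^sub>C x) = a *\<^sub>C inv T x" for a x
    using assms(1) by (metis T_inv inv_T bounded_clinear_def)
  ultimately show ?thesis
    by (simp add: bounded_clinear_def)
qed

text \<open>The adjoint for the real inner product is complex linear, since multiplication by \<open>c\<close> has the
  adjoint multiplication by \<open>cnj c\<close>, and \<open>T\<close> commutes with both. It is therefore also the adjoint for
  the complex inner product.\<close>

lemma adjoint_op:
  fixes T :: "'a::complex_hilbert \<Rightarrow> 'a"
  assumes "bounded_clinear T"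
  shows bounded_clinear_adjoint: "bounded_clinear (adjoint_op T)"
    and inner_adjoint: "inner (T x) y = inner x (adjoint_op T y)"
proof -
  have T: "bounded_linear T" "\<And>c x. T (c *\<^sub>C x) = c *\<^sub>C T x"
    using assms by (auto simp: bounded_clinear_def)
  obtain S where S: "bounded_linear S" "\<And>x y. inner (T x) y = inner x (S y)"
    using real_adjoint_exists[OF T(1)] by blast
  have "S (c *\<^sub>C y) = c *\<^sub>C S y" for c y
  proof (rule vector_eq_ldot[THEN iffD1], rule allI)
    fix x
    have "inner x (S (c *\<^sub>C y)) = inner (T (cnj c *\<^sub>C x)) y"
      using inner_scaleC_left[of "cnj c" "T x" y] by (simp add: S(2) [symmetric] T(2))
    then show "inner x (S (c *\<^sub>C y)) = inner x (c *\<^sub>C S y)"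
      by (simp add: S(2) inner_scaleC_left)
  qed
  with S(1) have clin: "bounded_clinear S"
    by (simp add: bounded_clinear_def)
  have "cinner (T x) y = cinner x (S y)" for x y
    by (intro complex_eqI)
      (simp_all add: Im_cinner S(2) flip: inner_eq_Re_cinner T(2))
  then have "adjoint_op T = S"
    unfolding adjoint_op_def
  proof (intro the_equality conjI clin allI)
    fix S' assume S': "bounded_clinear S' \<and> (\<forall>x y. cinner (T x) y = cinner x (S' y))"
    show "S' = S"
    proof
      fix y
      have "inner x (S' y) = inner x (S y)" for x
        using S' by (metis S(2) inner_eq_Re_cinner)
      then show "S' y = S y"
        using vector_eq_ldot by blast
    qed
  qed
  with clin S(2) show "bounded_clinear (adjoint_op T)" "inner (T x) y = inner x (adjoint_op T y)"
    by auto
qed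

lemma positive_op_of_symmetric:
  assumes "bounded_clinear A" "\<And>x y. inner (A x) y = inner x (A y)" "\<And>x. 0 \<le> inner (A x) x"
  shows "positive_op A"
proof -
  have "Im (cinner (A x) x) = 0" for x
  proof -
    have "Im (cinner (A x) x) = inner (A ((- \<i>) *\<^sub>C x)) x"
      using assms(1) by (simp add: Im_cinner bounded_clinear_def)
    also have "\<dots> = Im (cinner x (A x))"
      by (simp add: assms(2) Im_cinner)
    also have "\<dots> = - Im (cinner (A x) x)"
      by (subst cinner_commute) simp
    finally show ?thesis by simp
  qed
  then show ?thesis
    using assms(1,3) by (simp add: positive_op_def complex_is_Real_iff inner_eq_Re_cinner)
qed

text \<open>The real square root \<open>P\<close> is complex linear because multiplication by \<open>c\<close> commutes with \<open>A\<close>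
  and hence with \<open>P\<close>. Any other positive square root \<open>Q\<close> of \<open>A\<close> commutes with \<open>A = Q\<^sup>2\<close>, hence with
  \<open>P\<close>, and so equals \<open>P\<close>.\<close>

lemma sqrt_op_coercive:
  fixes A :: "'a::complex_hilbert \<Rightarrow> 'a"
  assumes A: "bounded_clinear A" "coercive_symmetric A"
  shows sqrt_op_clinear: "bounded_clinear (sqrt_op A)"
    and sqrt_op_coercive_symmetric: "coercive_symmetric (sqrt_op A)"
    and sqrt_op_square: "sqrt_op A \<circ> sqrt_op A = A"
proof -
  obtain P where P: "coercive_symmetric P" "P \<circ> P = A"
    and comm: "\<And>C. bounded_linear C \<Longrightarrow> C \<circ> A = A \<circ> C \<Longrightarrow> C \<circ> P = P \<circ> C"
    using coercive_symmetric_sqrt[OF A(2)] by blast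
  have "P (c *\<^sub>C x) = c *\<^sub>C P x" for c x
  proof -
    have "(\<lambda>x. c *\<^sub>C x) \<circ> P = P \<circ> (\<lambda>x. c *\<^sub>C x)"
      using A(1) by (intro comm bounded_linear_scaleC) (auto simp: bounded_clinear_def)
    then show ?thesis
      by (metis comp_apply)
  qed
  with P(1) have clin: "bounded_clinear P"
    by (simp add: bounded_clinear_def coercive_symmetric_def)
  have nonneg: "0 \<le> inner (P x) x" for x
    using P(1) unfolding coercive_symmetric_def
    by (meson less_imp_le mult_nonneg_nonneg order_trans zero_le_power2)
  have pos: "positive_op P"
    using clin P(1) nonneg by (intro positive_op_of_symmetric) (auto simp: coercive_symmetric_def)
  have "sqrt_op A = P"
    unfolding sqrt_op_def
  proof (intro the_equality conjI pos P(2))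
    fix Q assume Q: "positive_op Q \<and> Q \<circ> Q = A"
    then have lin: "bounded_linear Q" and nn: "\<And>x. 0 \<le> inner (Q x) x"
      by (auto simp: positive_op_def bounded_clinear_def inner_eq_Re_cinner)
    have "Q \<circ> A = A \<circ> Q"
      using Q by (metis comp_assoc)
    then have "Q \<circ> P = P \<circ> Q"
      by (rule comm[OF lin])
    moreover have "Q \<circ> Q = P \<circ> P"
      by (simp only: P(2) Q)
    ultimately show "Q = P"
      by (intro nonneg_sqrt_unique[OF P(1) lin nn])
  qed
  with clin P show "bounded_clinear (sqrt_op A)" "coercive_symmetric (sqrt_op A)"
    "sqrt_op A \<circ> sqrt_op A = A"
    by auto
qed

lemma bij_of_bij_square:
  assumes "bij (f \<circ> f)"
  shows "bij f"
proof (rule bijI)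
  show "inj f"
    using assms by (metis bij_is_inj inj_on_imageI2)
  show "surj f"
    by (rule surjI[of f "\<lambda>x. f (inv (f \<circ> f) x)"]) (use surj_f_inv_f[OF bij_is_surj[OF assms]] in simp)
qed

section \<open>The polar decomposition of an invertible operator\<close>

text \<open>Coercivity of \<open>T\<^sup>* T\<close> is \<open>\<langle>T\<^sup>* T x, x\<rangle> = \<parallel>T x\<parallel>\<^sup>2 \<ge> \<parallel>x\<parallel>\<^sup>2 / K\<^sup>2\<close>, where \<open>K\<close> bounds the inverse
  \<open>S\<close> of \<open>T\<close>. It is bijective because \<open>S\<^sup>*\<close> is the inverse of \<open>T\<^sup>*\<close>.\<close>

lemma adjoint_comp_self_invertible:
  assumes "invertible_op T"
  shows "bounded_clinear (adjoint_op T \<circ> T)" "coercive_symmetric (adjoint_op T \<circ> T)"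
    "bij (adjoint_op T \<circ> T)"
proof -
  obtain S where T: "bounded_clinear T" and S: "bounded_clinear S" "S \<circ> T = id" "T \<circ> S = id"
    using assms unfolding invertible_op_def by blast
  show clin: "bounded_clinear (adjoint_op T \<circ> T)"
    using T by (intro bounded_clinear_comp bounded_clinear_adjoint)
  have ST: "S (T x) = x" and TS: "T (S x) = x" for x
    using S(2,3) by (metis comp_apply id_apply)+
  have inner_eq: "inner ((adjoint_op T \<circ> T) x) y = inner (T x) (T y)" for x y
    by (metis T comp_apply inner_adjoint inner_commute)
  obtain K where K: "K > 0" "\<And>x. norm (S x) \<le> norm x * K"
    using S(1) bounded_linear.pos_bounded unfolding bounded_clinear_def by blast
  have "(1 / K)\<^sup>2 * (norm x)\<^sup>2 \<le> inner ((adjoint_op T \<circ> T) x) x" for x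
  proof -
    have "(1 / K) * norm x \<le> norm (T x)"
      using K(1) K(2)[of "T x"] by (simp add: ST field_simps)
    then have "((1 / K) * norm x)\<^sup>2 \<le> (norm (T x))\<^sup>2"
      using K(1) by (intro power_mono) auto
    then show ?thesis
      by (simp only: inner_eq power_mult_distrib power2_norm_eq_inner)
  qed
  moreover have "(1 / K)\<^sup>2 > 0"
    using K by simp
  moreover have "inner ((adjoint_op T \<circ> T) x) y = inner x ((adjoint_op T \<circ> T) y)" for x y
    by (metis inner_commute inner_eq)
  ultimately show "coercive_symmetric (adjoint_op T \<circ> T)"
    using clin unfolding coercive_symmetric_def bounded_clinear_def by blast
  have "adjoint_op T (adjoint_op S y) = y" for y
    by (rule vector_eq_ldot[THEN iffD1]) (simp add: ST flip: inner_adjoint[OF T] inner_adjoint[OF S(1)])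
  moreover have "adjoint_op S (adjoint_op T y) = y" for y
    by (rule vector_eq_ldot[THEN iffD1]) (simp add: TS flip: inner_adjoint[OF T] inner_adjoint[OF S(1)])
  ultimately have "bij (adjoint_op T)"
    by (metis bijI')
  moreover have "bij T"
    using ST TS by (metis bijI')
  ultimately show "bij (adjoint_op T \<circ> T)"
    by (simp add: bij_comp)
qed

lemma abs_op_invertible:
  assumes "invertible_op T"
  shows "bounded_clinear (abs_op T)" "coercive_symmetric (abs_op T)" "bij (abs_op T)"
    "norm (abs_op T x) = norm (T x)"
proof -
  note AT = adjoint_comp_self_invertible[OF assms]
  have sq: "abs_op T \<circ> abs_op T = adjoint_op T \<circ> T"
    unfolding abs_op_def by (rule sqrt_op_square[OF AT(1,2)])
  show "bounded_clinear (abs_op T)"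
    unfolding abs_op_def by (rule sqrt_op_clinear[OF AT(1,2)])
  show sym: "coercive_symmetric (abs_op T)"
    unfolding abs_op_def by (rule sqrt_op_coercive_symmetric[OF AT(1,2)])
  show "bij (abs_op T)"
    by (rule bij_of_bij_square) (simp only: sq AT(3))
  have T: "bounded_clinear T"
    using assms by (simp add: invertible_op_def)
  have "inner (abs_op T x) (abs_op T x) = inner x ((abs_op T \<circ> abs_op T) x)"
    using sym unfolding coercive_symmetric_def comp_apply by blast
  also have "\<dots> = inner (T x) (T x)"
    by (simp only: sq comp_apply inner_adjoint[OF T])
  finally show "norm (abs_op T x) = norm (T x)"
    by (simp add: norm_eq_sqrt_inner)
qed

text \<open>As \<open>|T|\<close> is surjective, \<open>T = U |T|\<close> leaves only one candidate for \<open>U\<close>. It is isometric because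
  \<open>\<parallel>|T| x\<parallel> = \<parallel>T x\<parallel>\<close>, and the kernel conditions hold because all kernels are trivial.\<close>

lemma polar_isometry_invertible:
  assumes "invertible_op T"
  shows "polar_isometry T = T \<circ> inv (abs_op T)"
proof -
  define P where "P = abs_op T"
  note P = abs_op_invertible[OF assms, folded P_def]
  have T: "bounded_clinear T" "bij T"
    using assms by (auto simp: invertible_op_def o_bij)
  have P_inv: "P (inv P x) = x" and inv_P: "inv P (P x) = x" for x
    using P(3) by (simp_all add: bij_is_surj bij_is_inj surj_f_inv_f inv_f_f)
  have kernel: "op_kernel A = {0}" if "bounded_clinear A" "bij A" for A :: "'a \<Rightarrow> 'a"
  proof -
    have "A 0 = 0"
      using that(1) by (simp add: bounded_clinear_def linear_simps(3))
    then have "A x = 0 \<longleftrightarrow> x = 0" for x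
      using inj_eq[OF bij_is_inj[OF that(2)], of x 0] by simp
    then show ?thesis
      by (simp add: op_kernel_def)
  qed
  obtain c where "c > 0" "\<And>x. c * norm x \<le> norm (P x)"
    using coercive_symmetric_expanding[OF P(2)] by blast
  then have inv: "bounded_clinear (inv P)"
    by (rule bounded_clinear_inverse[OF P(1,3)])
  have "(THE U. partial_isometry U \<and> T = U \<circ> P \<and> op_kernel U = op_kernel P \<and>
      op_kernel P = op_kernel T) = T \<circ> inv P"
  proof (intro the_equality conjI)
    show "partial_isometry (T \<circ> inv P)"
      unfolding partial_isometry_def
      using bounded_clinear_comp[OF T(1) inv] P(4) P_inv by (metis comp_apply)
    show "T = T \<circ> inv P \<circ> P"
      by (auto simp: inv_P)
    have "bij (T \<circ> inv P)"
      using T(2) P(3) by (simp add: bij_comp bij_imp_bij_inv)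
    with bounded_clinear_comp[OF T(1) inv] show "op_kernel (T \<circ> inv P) = op_kernel P"
      using kernel P(1,3) by metis
    show "op_kernel P = op_kernel T"
      using kernel P(1,3) T by metis
  next
    fix U assume "partial_isometry U \<and> T = U \<circ> P \<and> op_kernel U = op_kernel P \<and> op_kernel P = op_kernel T"
    then have "U (P x) = T x" for x
      by (metis comp_apply)
    from this[of "inv P _"] show "U = T \<circ> inv P"
      by (intro ext) (simp add: P_inv)
  qed
  then show ?thesis
    by (simp add: polar_isometry_def P_def)
qed

lemma aluthge_similar:
  fixes T :: "'a::complex_hilbert \<Rightarrow> 'a"
  assumes "invertible_op T"
  obtains Q where "bounded_clinear Q" "bounded_clinear (inv Q)" "bij Q" "aluthge T \<circ> Q = Q \<circ> T"
proof -
  note P = abs_op_invertible[OF assms]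
  define Q where "Q = sqrt_op (abs_op T)"
  have Q: "bounded_clinear Q" "coercive_symmetric Q" "Q \<circ> Q = abs_op T"
    unfolding Q_def using sqrt_op_coercive[OF P(1,2)] by auto
  have bij: "bij Q"
    by (rule bij_of_bij_square) (simp only: Q(3) P(3))
  obtain c where "c > 0" "\<And>x. c * norm x \<le> norm (Q x)"
    using coercive_symmetric_expanding[OF Q(2)] by blast
  then have "bounded_clinear (inv Q)"
    by (rule bounded_clinear_inverse[OF Q(1) bij])
  moreover have "aluthge T \<circ> Q = Q \<circ> T"
  proof -
    have "aluthge T \<circ> Q = Q \<circ> T \<circ> (inv (abs_op T) \<circ> (Q \<circ> Q))"
      by (simp add: aluthge_def polar_isometry_invertible[OF assms] comp_assoc flip: Q_def)
    also have "inv (abs_op T) \<circ> (Q \<circ> Q) = id"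
      using P(3) by (simp add: Q(3) bij_is_inj)
    finally show ?thesis by (simp only: comp_id)
  qed
  ultimately show thesis
    using Q(1) bij that by blast
qed

section \<open>Bounded shadowing under bi-Lipschitz conjugacy\<close>

lemma int_iterate_conjugate:
  assumes "bij g" "bij h" "h \<circ> f = f \<circ> g"
  shows "int_iterate h n (f x) = f (int_iterate g n x)"
proof -
  have fw: "(h ^^ k) (f x) = f ((g ^^ k) x)" for k
    using assms(3) by (induction k) (simp_all, metis comp_apply)
  have "inv h (f y) = f (inv g y)" for y
    using assms by (metis bij_inv_eq_iff comp_apply)
  then have "(inv h ^^ k) (f x) = f ((inv g ^^ k) x)" for k
    by (induction k) simp_all
  with fw show ?thesis
    by (simp add: int_iterate_def)
qed

text \<open>A pseudo orbit of \<open>h\<close> is pulled back by \<open>inv f\<close>, shadowed there, and the shadowing point is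
  pushed forward by \<open>f\<close>. The Lipschitz condition on \<open>inv f\<close> also keeps the pulled back pseudo orbit
  bounded, which uniform continuity alone would not ensure.\<close>

lemma bounded_shadowing_conjugate:
  fixes g :: "'a::metric_space \<Rightarrow> 'a" and h :: "'b::metric_space \<Rightarrow> 'b"
  assumes g: "bounded_shadowing g" and f: "bij f" "K-lipschitz_on UNIV f" "L-lipschitz_on UNIV (inv f)"
    and conj: "h \<circ> f = f \<circ> g"
  shows "bounded_shadowing h"
proof -
  have f_inv: "f (inv f x) = x" and inv_f: "inv f (f y) = y" for x y
    using f(1) by (simp_all add: bij_is_surj bij_is_inj surj_f_inv_f inv_f_f)
  have homeo: "homeomorphism UNIV UNIV g (inv g)"
    using g by (simp add: bounded_shadowing_def)
  then have "inv g (g x) = x" "g (inv g x) = x" for x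
    by (simp_all add: homeomorphism_def)
  then have g_bij: "bij g"
    by (metis bijI')
  have h_eq: "h = f \<circ> g \<circ> inv f"
    using conj by (auto simp: fun_eq_iff) (metis f_inv)
  have h_bij: "bij h"
    unfolding h_eq using f(1) g_bij by (intro bij_comp bij_imp_bij_inv)
  have inv_h: "inv h = f \<circ> inv g \<circ> inv f"
    unfolding h_eq using f(1) g_bij
    by (simp add: o_inv_distrib bij_comp bij_imp_bij_inv inv_inv_eq comp_assoc)
  have cont: "continuous_on UNIV f" "continuous_on UNIV (inv f)"
    using f lipschitz_on_continuous_on by blast+
  have "homeomorphism UNIV UNIV h (inv h)"
  proof (rule homeomorphismI)
    have sandwich: "continuous_on UNIV (f \<circ> k \<circ> inv f)" if "continuous_on UNIV k" for k
      unfolding comp_def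
      by (intro continuous_on_compose2[OF cont(1)] continuous_on_compose2[OF that] cont subset_UNIV)
    show "continuous_on UNIV h" "continuous_on UNIV (inv h)"
      unfolding inv_h unfolding h_eq using homeo by (intro sandwich; simp only: homeomorphism_def)+
  qed (use h_bij in \<open>auto simp: bij_is_surj bij_is_inj surj_f_inv_f\<close>)
  moreover have "\<exists>\<delta>>0. \<forall>y. pseudo_orbit h \<delta> y \<and> bounded (range y) \<longrightarrow> shadowed h \<epsilon> y"
    if "\<epsilon> > 0" for \<epsilon>
  proof -
    have K: "K \<ge> 0" and L: "L \<ge> 0"
      using f lipschitz_on_nonneg by blast+
    \<comment> \<open>The Lipschitz constants may be \<open>0\<close>; adding \<open>1\<close> makes them safe divisors.\<close>
    have "\<epsilon> / (K + 1) > 0"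
      using that K by simp
    then obtain \<delta> where \<delta>: "\<delta> > 0" and shadow:
      "\<And>y. pseudo_orbit g \<delta> y \<Longrightarrow> bounded (range y) \<Longrightarrow> shadowed g (\<epsilon> / (K + 1)) y"
      using g unfolding bounded_shadowing_def by blast
    have "shadowed h \<epsilon> y" if y: "pseudo_orbit h (\<delta> / (L + 1)) y" "bounded (range y)" for y
    proof -
      define z where "z n = inv f (y n)" for n
      have y_eq: "y n = f (z n)" for n
        by (simp add: z_def f_inv)
      have L_dist: "dist (inv f u) (inv f v) \<le> L * dist u v" for u v
        using lipschitz_onD[OF f(3)] by simp
      have "dist (g (z n)) (z (n + 1)) \<le> \<delta>" for n
      proof -
        have "g (z n) = inv f (h (y n))"
          by (simp add: h_eq inv_f z_def)
        then have "dist (g (z n)) (z (n + 1)) \<le> L * dist (h (y n)) (y (n + 1))"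
          using L_dist by (simp add: z_def)
        also have "\<dots> \<le> L * (\<delta> / (L + 1))"
          using y(1) L by (intro mult_left_mono) (auto simp: pseudo_orbit_def)
        also have "\<dots> \<le> \<delta>"
          using L \<delta> by (simp add: field_simps)
        finally show ?thesis .
      qed
      then have "pseudo_orbit g \<delta> z"
        by (simp add: pseudo_orbit_def)
      moreover have "bounded (range z)"
      proof -
        obtain a e where "\<And>n. dist a (y n) \<le> e"
          using y(2) by (auto simp: bounded_def)
        then have "dist (inv f a) (z n) \<le> L * e" for n
          unfolding z_def using L_dist L by (meson mult_left_mono order_trans)
        then show ?thesis
          unfolding bounded_def by blast
      qed
      ultimately obtain x where x: "\<And>n. dist (int_iterate g n x) (z n) \<le> \<epsilon> / (K + 1)"
        using shadow unfolding shadowed_def by blast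
      have "dist (int_iterate h n (f x)) (y n) \<le> \<epsilon>" for n
      proof -
        have "dist (int_iterate h n (f x)) (y n) \<le> K * dist (int_iterate g n x) (z n)"
          using lipschitz_onD[OF f(2)] by (simp add: int_iterate_conjugate[OF g_bij h_bij conj] y_eq)
        also have "\<dots> \<le> K * (\<epsilon> / (K + 1))"
          using x K by (intro mult_left_mono)
        also have "\<dots> \<le> \<epsilon>"
          using K \<open>\<epsilon> > 0\<close> by (simp add: field_simps)
        finally show ?thesis .
      qed
      then show ?thesis
        unfolding shadowed_def by blast
    qed
    moreover have "\<delta> / (L + 1) > 0"
      using \<delta> L by simp
    ultimately show ?thesis by blast
  qed
  ultimately show ?thesis
    by (simp add: bounded_shadowing_def)
qed

lemma bounded_linear_lipschitz_on:
  assumes "bounded_linear f"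
  obtains K where "K-lipschitz_on UNIV f"
proof -
  interpret f: bounded_linear f by fact
  obtain K where "K \<ge> 0" "\<And>x. norm (f x) \<le> norm x * K"
    using f.nonneg_bounded by blast
  then have "K-lipschitz_on UNIV f"
    by (intro lipschitz_onI) (auto simp: dist_norm mult.commute simp flip: f.diff)
  then show thesis by (rule that)
qed

theorem theorem2p2:
  fixes T :: "'a::complex_hilbert \<Rightarrow> 'a"
  assumes "invertible_op T"
  shows "bounded_shadowing T \<longleftrightarrow> bounded_shadowing (aluthge T)"
proof -
  obtain Q where "bounded_clinear Q" "bounded_clinear (inv Q)" and bij: "bij Q"
    and conj: "aluthge T \<circ> Q = Q \<circ> T"
    using aluthge_similar[OF assms] by blast
  then obtain K L where lip: "K-lipschitz_on UNIV Q" "L-lipschitz_on UNIV (inv Q)"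
    unfolding bounded_clinear_def by (meson bounded_linear_lipschitz_on)
  have inv_conj: "T \<circ> inv Q = inv Q \<circ> aluthge T"
    using bij conj by (auto simp: fun_eq_iff) (metis bij_inv_eq_iff)
  show ?thesis
  proof
    show "bounded_shadowing (aluthge T)" if "bounded_shadowing T"
      using bounded_shadowing_conjugate[OF that bij lip conj] .
    show "bounded_shadowing T" if "bounded_shadowing (aluthge T)"
      using bounded_shadowing_conjugate[OF that bij_imp_bij_inv[OF bij] lip(2) _ inv_conj] lip(1) bij
      by (simp add: inv_inv_eq)
  qed
qed

end
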